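(* Let $u$ be a fixed real number with $0<u<1$. Suppose that, as $z\to+\infty$, $$\Pi(z,z^u)=z^{1+o(1)}.$$ Then, as $x\to+\infty$, $$\mathcal N_{\mathcal C}(x)\gg x^{1-u+o(1)}.$$
   Context: A positive integer $N$ is called a Novák-Carmichael number if $a^N\equiv 1 \pmod N$ for every integer $a$ coprime to $N$. For real $x$, $\mathcal N_{\mathcal C}(x)$ denotes the number of Novák-Carmichael numbers $N\le x$. For real $x,y>0$, $\mathcal P(x,y)$ is the set of primes $p\le x$ such that every prime factor of $p-1$ is at most $y$ (i.e. the largest prime factor of $p-1$ is $\le y$), and $\Pi(x,y)=\#\mathcal P(x,y)$. *)

theory Defs
  imports
    "HOL-Number_Theory.Number_Theory"
    "HOL-Library.Landau_Symbols"
begin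

definition novak_carmichael :: "nat \<Rightarrow> bool" where
  "novak_carmichael N \<longleftrightarrow>
     N > 0 \<and> (\<forall>a::int. coprime a (int N) \<longrightarrow> [a ^ N = 1] (mod int N))"

definition novak_carmichael_count :: "real \<Rightarrow> nat" where
  "novak_carmichael_count x = card {N::nat. novak_carmichael N \<and> real N \<le> x}"

definition smooth_shifted_primes :: "real \<Rightarrow> real \<Rightarrow> nat set" where
  "smooth_shifted_primes x y =
     {p::nat. prime p \<and> real p \<le> x \<and> (\<forall>q\<in>prime_factors (p - 1). real q \<le> y)}"

definition smooth_shifted_prime_count :: "real \<Rightarrow> real \<Rightarrow> nat" where
  "smooth_shifted_prime_count x y = card (smooth_shifted_primes x y)"

end

theory Submission
  imports Defs "HOL-Real_Asymp.Real_Asymp"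
begin

text \<open>
  If \<open>p - 1\<close> divides \<open>N\<close> for every prime \<open>p\<close> dividing \<open>N\<close>, then \<open>N\<close> is a Novak-Carmichael number.
  Put \<open>y = z\<^sup>u\<close> and let \<open>M\<close> be the least common multiple of the \<open>y\<close>-smooth integers up to \<open>z\<close>,
  so \<open>M \<le> z\<^sup>y\<close>. Then \<open>M\<close> times any product of \<open>k\<close> distinct primes from \<open>P(z, y)\<close> satisfies the
  criterion, and such numbers are at most \<open>z\<^bsup>y + k\<^esup>\<close>. For \<open>x = exp (z\<^sup>v)\<close> with \<open>v\<close> slightly larger
  than \<open>u\<close>, the factor \<open>M\<close> is \<open>x\<^bsup>o(1)\<^esup>\<close>, and one can take \<open>k\<close> close to \<open>ln x / ln z \<le> z\<^sup>v\<close>; the number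
  of choices is at least \<open>(\<Pi>(z, y) / k)\<^sup>k \<ge> z\<^bsup>(1 - v - o(1)) k\<^esup> = x\<^bsup>1 - v - o(1)\<^esup>\<close>.
\<close>

section \<open>Divisibility criterion\<close>

text \<open>For \<open>p ^ k\<close> exactly dividing \<open>N\<close>, the totient
  \<open>p ^ (k - 1) * (p - 1)\<close> has coprime factors that both divide \<open>N\<close>.
  Euler's theorem then gives the congruence modulo \<open>p ^ k\<close>, and these pairwise coprime
  moduli multiply to \<open>N\<close>.\<close>

lemma novak_carmichaelI:
  fixes N :: nat
  assumes "N > 0" and "\<And>p. prime p \<Longrightarrow> p dvd N \<Longrightarrow> p - 1 dvd N"
  shows "novak_carmichael N"
  unfolding novak_carmichael_def
proof (intro conjI allI impI)
  fix a :: int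
  assume a: "coprime a (int N)"
  define b where "b = nat (a mod int N)"
  have b: "int b = a mod int N"
    using \<open>N > 0\<close> by (simp add: b_def)
  have "coprime (int b) (int N)"
    using a \<open>N > 0\<close> by (simp add: b)
  then have cop: "coprime b N"
    by simp
  have "[b ^ N = 1] (mod p ^ multiplicity p N)" if p: "p \<in> prime_factors N" for p
  proof -
    have "prime p" "p dvd N"
      using p by auto
    define k where "k = multiplicity p N"
    have "k > 0"
      using p by (simp add: k_def prime_factors_multiplicity)
    have pk: "p ^ k dvd N"
      by (simp add: k_def multiplicity_dvd)
    have "p ^ (k - 1) dvd N"
      using pk by (meson dvd_trans diff_le_self le_imp_power_dvd)
    moreover have "coprime (p ^ (k - 1)) (p - 1)"
      using \<open>prime p\<close> by (metis coprime_diff_one_right_nat coprime_power_left_iff prime_gt_0_nat)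
    ultimately have "totient (p ^ k) dvd N"
      using assms(2)[OF \<open>prime p\<close> \<open>p dvd N\<close>] \<open>k > 0\<close>
      by (simp add: totient_prime_power[OF \<open>prime p\<close>] divides_mult)
    then obtain j where j: "N = totient (p ^ k) * j" ..
    have "coprime b (p ^ k)"
      using cop pk by (meson coprime_divisors dvd_refl)
    then have "[(b ^ totient (p ^ k)) ^ j = 1 ^ j] (mod p ^ k)"
      by (intro cong_pow euler_theorem)
    moreover have "(b ^ totient (p ^ k)) ^ j = b ^ N"
      using j by (metis power_mult)
    ultimately show ?thesis
      by (simp add: k_def)
  qed
  then have "[b ^ N = 1] (mod (\<Prod>p\<in>prime_factors N. p ^ multiplicity p N))"
    by (intro coprime_cong_prod_nat) (auto intro: primes_coprime)
  then have "[b ^ N = 1] (mod N)"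
    using prod_prime_factors[of N] \<open>N > 0\<close> by simp
  then have "[int b ^ N = 1] (mod int N)"
    by (metis cong_int_iff of_nat_1 of_nat_power)
  moreover have "[int b = a] (mod int N)"
    by (simp add: b)
  ultimately show "[a ^ N = 1] (mod int N)"
    using cong_pow cong_sym cong_trans by blast
qed (use assms in auto)

section \<open>Finiteness and the least common multiple of smooth integers\<close>

lemma finite_primes_le: "finite {q::nat. prime q \<and> real q \<le> y}"
  by (rule finite_subset[of _ "{..nat \<lfloor>y\<rfloor>}"]) (auto simp: le_nat_floor)

lemma finite_smooth_shifted_primes: "finite (smooth_shifted_primes x y)"
  by (rule finite_subset[OF _ finite_primes_le[of x]]) (auto simp: smooth_shifted_primes_def)

lemma finite_novak_carmichael_le: "finite {N. novak_carmichael N \<and> real N \<le> x}"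
  by (rule finite_subset[of _ "{..nat \<lfloor>x\<rfloor>}"]) (auto simp: le_nat_floor)

text \<open>For \<open>z \<ge> 1\<close> the exponent of \<open>q\<close> is the largest
  \<open>e\<close> with \<open>q ^ e \<le> z\<close>, so this is the least common multiple of the
  \<open>y\<close>-smooth positive integers up to \<open>z\<close>. The product form lets its size
  be bounded prime by prime.\<close>

definition smooth_lcm :: "real \<Rightarrow> real \<Rightarrow> nat" where
  "smooth_lcm z y = (\<Prod>q | prime q \<and> real q \<le> y. q ^ nat \<lfloor>log (real q) z\<rfloor>)"

lemma smooth_lcm_pos: "smooth_lcm z y > 0"
  by (auto simp: smooth_lcm_def prime_gt_0_nat intro!: prod_pos)

lemma dvd_smooth_lcm:
  assumes "n > 0" "real n \<le> z" "\<And>q. q \<in> prime_factors n \<Longrightarrow> real q \<le> y"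
  shows "n dvd smooth_lcm z y"
proof -
  have "multiplicity q n \<le> nat \<lfloor>log (real q) z\<rfloor>" if q: "q \<in> prime_factors n" for q
  proof -
    have "1 < q"
      using q prime_gt_1_nat by blast
    have "q ^ multiplicity q n \<le> n"
      using \<open>n > 0\<close> by (simp add: dvd_imp_le multiplicity_dvd)
    then have "real q ^ multiplicity q n \<le> z"
      using \<open>real n \<le> z\<close> by (metis of_nat_le_iff of_nat_power order_trans)
    then have "real (multiplicity q n) \<le> log (real q) z"
      using \<open>1 < q\<close> \<open>n > 0\<close> \<open>real n \<le> z\<close> by (simp add: le_log_iff powr_realpow)
    then show ?thesis
      by (simp add: le_nat_floor)
  qed
  then have "(\<Prod>q\<in>prime_factors n. q ^ multiplicity q n) dvd smooth_lcm z y"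
    unfolding smooth_lcm_def using assms(3)
    by (intro prod_dvd_prod_subset2[OF finite_primes_le]) (auto intro!: le_imp_power_dvd)
  then show ?thesis
    using prod_prime_factors[of n] \<open>n > 0\<close> by simp
qed

text \<open>Needed to check the criterion at the primes of the common factor itself: if
  \<open>p \<le> y\<close>, then \<open>p - 1\<close> is trivially \<open>y\<close>-smooth.\<close>

lemma prime_dvd_smooth_lcm:
  assumes "prime p" "p dvd smooth_lcm z y"
  shows "real p \<le> y"
proof -
  have "\<exists>q\<in>{q. prime q \<and> real q \<le> y}. p dvd q ^ nat \<lfloor>log (real q) z\<rfloor>"
    using assms(2) unfolding smooth_lcm_def
    by (subst (asm) prime_dvd_prod_iff[OF finite_primes_le assms(1)])
  then obtain q where "prime q" "real q \<le> y" "p dvd q ^ nat \<lfloor>log (real q) z\<rfloor>"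
    by blast
  then show ?thesis
    using assms(1) by (metis prime_dvd_power primes_dvd_imp_eq)
qed

text \<open>Each prime contributes at most \<open>z\<close>, and there are at most \<open>y\<close>
  primes, counted crudely by all positive integers up to \<open>y\<close>.\<close>

lemma smooth_lcm_le:
  assumes "z \<ge> 1" "y \<ge> 0"
  shows "real (smooth_lcm z y) \<le> z powr y"
proof -
  let ?A = "{q::nat. prime q \<and> real q \<le> y}"
  have "real (smooth_lcm z y) = (\<Prod>q\<in>?A. real q ^ nat \<lfloor>log (real q) z\<rfloor>)"
    by (simp add: smooth_lcm_def)
  also have "\<dots> \<le> (\<Prod>q\<in>?A. z)"
  proof (rule prod_mono)
    fix q :: nat assume "q \<in> ?A"
    then have q: "real q > 1"
      using prime_gt_1_nat by auto
    then have "log (real q) z \<ge> 0"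
      using assms by simp
    then have "real q ^ nat \<lfloor>log (real q) z\<rfloor> \<le> real q powr log (real q) z"
      using q by (simp add: powr_realpow[symmetric])
    then show "0 \<le> real q ^ nat \<lfloor>log (real q) z\<rfloor> \<and> real q ^ nat \<lfloor>log (real q) z\<rfloor> \<le> z"
      using q assms by simp
  qed
  also have "\<dots> = z powr real (card ?A)"
    using assms by (simp add: powr_realpow)
  also have "card ?A \<le> card {1..nat \<lfloor>y\<rfloor>}"
    by (intro card_mono) (auto simp: le_nat_floor dest: prime_ge_1_nat)
  then have "real (card ?A) \<le> y"
    using assms by simp linarith
  then have "z powr real (card ?A) \<le> z powr y"
    using assms by (intro powr_mono) auto
  finally show ?thesis .
qed

section \<open>Counting products of smooth shifted primes\<close>

lemma prod_primes_inject:
  assumes "finite S" "finite T" "\<And>p. p \<in> S \<union> T \<Longrightarrow> prime p" "\<Prod>S = \<Prod>(T::nat set)"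
  shows "S = T"
proof -
  have "p dvd \<Prod>U \<longleftrightarrow> p \<in> U" if "finite U" "U \<subseteq> S \<union> T" "prime p" for p and U :: "nat set"
  proof -
    have "p dvd q \<longleftrightarrow> p = q" if "q \<in> U" for q
      using that \<open>U \<subseteq> S \<union> T\<close> assms(3)[of q] \<open>prime p\<close> primes_dvd_imp_eq[of p q] by auto
    then show ?thesis
      using that by (auto simp: prime_dvd_prod_iff)
  qed
  from this[of S] this[of T] have "p \<in> S \<longleftrightarrow> p \<in> T" if "prime p" for p
    using that assms by simp
  then show ?thesis
    using assms(3) by blast
qed

text \<open>A \<open>k\<close>-subset \<open>S\<close> is sent to \<open>?M * \<Prod>S\<close>. A
  prime \<open>p\<close> dividing this number divides \<open>?M\<close> or lies in \<open>S\<close>;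
  in both cases \<open>p - 1\<close> is \<open>y\<close>-smooth and at most \<open>z\<close>, hence
  divides \<open>?M\<close>. Overlap between \<open>S\<close> and the primes of \<open>?M\<close> is
  harmless: the fixed factor \<open>?M\<close> cancels, and \<open>\<Prod>S\<close> determines
  \<open>S\<close>.\<close>

lemma choose_le_novak_carmichael_count:
  assumes "z \<ge> 1" "0 \<le> y" "y \<le> z" and x: "z powr y * z ^ k \<le> x"
  shows "smooth_shifted_prime_count z y choose k \<le> novak_carmichael_count x"
proof -
  let ?P = "smooth_shifted_primes z y" and ?M = "smooth_lcm z y"
  let ?f = "\<lambda>S. ?M * \<Prod>S"
  have P: "prime p" "real p \<le> z" "p - 1 dvd ?M" if "p \<in> ?P" for p
  proof -
    show p: "prime p" "real p \<le> z"
      using that by (auto simp: smooth_shifted_primes_def)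
    show "p - 1 dvd ?M"
      using that p prime_gt_1_nat[OF p(1)]
      by (intro dvd_smooth_lcm) (auto simp: smooth_shifted_primes_def)
  qed
  have M: "p - 1 dvd ?M" if "prime p" "p dvd ?M" for p
  proof (rule dvd_smooth_lcm)
    have y: "real p \<le> y"
      using prime_dvd_smooth_lcm that .
    show "p - 1 > 0" using prime_gt_1_nat[OF that(1)] by simp
    show "real (p - 1) \<le> z" using y assms by linarith
    show "real q \<le> y" if "q \<in> prime_factors (p - 1)" for q
    proof -
      have "q \<le> p - 1"
        using that \<open>p - 1 > 0\<close> by (auto intro: dvd_imp_le)
      then show ?thesis using y by linarith
    qed
  qed
  have nc: "novak_carmichael (?f S) \<and> real (?f S) \<le> x" if S: "S \<subseteq> ?P" "card S = k" for S
  proof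
    have fin: "finite S"
      using S finite_smooth_shifted_primes finite_subset by blast
    show "novak_carmichael (?f S)"
    proof (rule novak_carmichaelI)
      show "?f S > 0"
        using smooth_lcm_pos P(1) S by (auto intro!: prod_pos simp: prime_gt_0_nat subset_iff)
      fix p :: nat assume p: "prime p" "p dvd ?f S"
      then consider "p dvd ?M" | q where "q \<in> S" "p dvd q"
        using fin by (auto simp: prime_dvd_mult_iff prime_dvd_prod_iff)
      then have "p - 1 dvd ?M"
      proof cases
        case 1
        then show ?thesis using M p by blast
      next
        case 2
        then have "p = q" using P(1) S p primes_dvd_imp_eq by blast
        then show ?thesis using P(3) 2 S by blast
      qed
      then show "p - 1 dvd ?f S" by simp
    qed
    have "(\<Prod>p\<in>S. real p) \<le> (\<Prod>p\<in>S. z)"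
      using P(2) S by (intro prod_mono) auto
    then have "real (\<Prod>S) \<le> z ^ k"
      using S by simp
    moreover have "real ?M \<le> z powr y"
      using smooth_lcm_le assms by blast
    ultimately have "real ?M * real (\<Prod>S) \<le> z powr y * z ^ k"
      using assms by (intro mult_mono) (auto intro: prod_nonneg)
    then show "real (?f S) \<le> x"
      using x by simp
  qed
  have "inj_on ?f {S. S \<subseteq> ?P \<and> card S = k}"
  proof (rule inj_onI)
    fix S T assume ST: "S \<in> {S. S \<subseteq> ?P \<and> card S = k}" "T \<in> {S. S \<subseteq> ?P \<and> card S = k}"
      and "?f S = ?f T"
    then have "\<Prod>S = \<Prod>T"
      using smooth_lcm_pos[of z y] by simp
    moreover have "finite S" "finite T"
      using ST finite_smooth_shifted_primes finite_subset by blast+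
    moreover have "prime p" if "p \<in> S \<union> T" for p
      using ST P(1) that by blast
    ultimately show "S = T"
      using prod_primes_inject by metis
  qed
  then have "card {S. S \<subseteq> ?P \<and> card S = k} \<le> card {N. novak_carmichael N \<and> real N \<le> x}"
    using nc finite_novak_carmichael_le by (intro card_inj_on_le[of ?f]) auto
  then show ?thesis
    by (simp add: n_subsets[OF finite_smooth_shifted_primes] novak_carmichael_count_def
        smooth_shifted_prime_count_def)
qed

text \<open>The loss \<open>3 * d\<close> has three equal sources: \<open>v\<close> exceeds
  \<open>u\<close> by \<open>d\<close>, \<open>many\<close> gives up \<open>d\<close>, and by
  \<open>small\<close> the common factor and the rounding of \<open>k\<close> cost at most the share
  \<open>d\<close> of \<open>ln x = z powr v\<close>.\<close>

lemma novak_carmichael_count_ge: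
  fixes u d z :: real
  defines "v \<equiv> u + d"
  assumes "0 < u" "0 < d" "u + 2 * d < 1"
    and z: "z \<ge> exp 1"
    and small: "(z powr u + 1) * ln z \<le> d * z powr v"
    and many: "real (smooth_shifted_prime_count z (z powr u)) \<ge> z powr (1 - d)"
  shows "real (novak_carmichael_count (exp (z powr v))) \<ge> exp (z powr v) powr (1 - u - 3 * d)"
proof -
  let ?n = "smooth_shifted_prime_count z (z powr u)" and ?L = "z powr v"
  \<comment> \<open>The largest \<open>k\<close> for which
    \<open>(z powr u + k) * ln z \<le> ?L\<close>, that is, for which the constructed numbers stay
    below \<open>exp ?L\<close>.\<close>
  define k where "k = nat \<lfloor>?L / ln z - z powr u\<rfloor>"
  have z1: "z > 1"
    using z exp_gt_one[of 1] by linarith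
  have lnz: "ln z \<ge> 1"
    using z z1 by (simp add: ln_ge_iff)
  have L: "?L > 0"
    using z1 by simp
  \<comment> \<open>Makes the argument of the floor nonnegative, so that \<open>nat\<close> does not
    truncate.\<close>
  have "z powr u * ln z \<le> ?L"
  proof -
    have "d * ?L \<le> 1 * ?L"
      using L \<open>u + 2 * d < 1\<close> \<open>0 < u\<close> \<open>0 < d\<close> by (intro mult_right_mono) auto
    moreover have "z powr u * ln z \<le> (z powr u + 1) * ln z"
      using lnz by (intro mult_right_mono) auto
    ultimately show ?thesis
      using small by linarith
  qed
  then have "?L / ln z - z powr u \<ge> 0"
    using lnz by (simp add: field_simps)
  then have k: "real k \<le> ?L / ln z - z powr u" "real k > ?L / ln z - z powr u - 1"
    unfolding k_def by linarith+
  have kupper: "real k * ln z \<le> ?L - z powr u * ln z"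
    using k(1) lnz by (simp add: field_simps)
  have "?L < (real k + z powr u + 1) * ln z"
    using k(2) lnz by (simp add: field_simps)
  then have klower: "real k * ln z \<ge> (1 - d) * ?L"
    using small by (simp add: algebra_simps)
  moreover have "(1 - d) * ?L > 0"
    using L \<open>u + 2 * d < 1\<close> \<open>0 < u\<close> \<open>0 < d\<close> by simp
  ultimately have "k > 0"
    using lnz by (cases k) auto
  have "?L / ln z \<le> ?L"
    using lnz L by (simp add: field_simps)
  moreover have "z powr u \<ge> 0" by simp
  ultimately have kL: "real k \<le> ?L"
    using k(1) by linarith
  \<comment> \<open>Here \<open>v = u + d \<le> 1 - d\<close>; so enough primes are available to
    choose \<open>k\<close> of them.\<close>
  have "?L \<le> z powr (1 - d)"
    using z1 assms by (intro powr_mono) auto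
  then have kn: "k \<le> ?n"
    using kL many by linarith
  have "z powr (z powr u) * z ^ k = exp (z powr u * ln z + real k * ln z)"
    using z1 by (simp add: powr_def exp_add powr_realpow[symmetric])
  also have "\<dots> \<le> exp ?L"
    using kupper by simp
  finally have choose: "?n choose k \<le> novak_carmichael_count (exp ?L)"
    using z1 \<open>0 < u\<close> \<open>u + 2 * d < 1\<close> \<open>0 < d\<close> powr_mono[of u 1 z]
    by (intro choose_le_novak_carmichael_count) auto
  have "exp ?L powr (1 - u - 3 * d) \<le> exp ((1 - u - 2 * d) * ((1 - d) * ?L))"
  proof -
    have "(1 - u - 2 * d) * (1 - d) = 1 - u - 3 * d + d * (u + 2 * d)"
      by (simp add: algebra_simps)
    then have "1 - u - 3 * d \<le> (1 - u - 2 * d) * (1 - d)"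
      using assms(2,3) by simp
    then have "(1 - u - 3 * d) * ?L \<le> (1 - u - 2 * d) * (1 - d) * ?L"
      using L by (intro mult_right_mono) auto
    then show ?thesis
      by (simp add: powr_def mult.assoc)
  qed
  also have "\<dots> \<le> exp ((1 - u - 2 * d) * (real k * ln z))"
    using klower \<open>u + 2 * d < 1\<close> by (intro exp_mono mult_left_mono) auto
  also have "\<dots> = (z powr (1 - u - 2 * d)) ^ k"
    using z1 by (simp add: powr_def exp_of_nat_mult[symmetric] algebra_simps)
  also have "\<dots> \<le> (real ?n / real k) ^ k"
  proof (rule power_mono)
    have "z powr (1 - u - 2 * d) = z powr (1 - d) / ?L"
      by (simp add: v_def flip: powr_diff)
    also have "\<dots> \<le> real ?n / real k"
      using many kL \<open>k > 0\<close> by (intro frac_le) auto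
    finally show "z powr (1 - u - 2 * d) \<le> real ?n / real k" .
  qed simp
  also have "\<dots> \<le> real (?n choose k)"
    using binomial_ge_n_over_k_pow_k[OF kn, where 'a = real] by simp
  also have "\<dots> \<le> real (novak_carmichael_count (exp ?L))"
    using choose by simp
  finally show ?thesis .
qed

section \<open>Passage to an asymptotic bound\<close>

lemma exists_little_o_exponent:
  fixes f :: "real \<Rightarrow> real"
  assumes "\<And>e. e > 0 \<Longrightarrow> \<forall>\<^sub>F x in at_top. f x \<ge> x powr (c - e)"
  shows "\<exists>\<delta>::real \<Rightarrow> real. \<delta> \<in> o[at_top](\<lambda>_. 1) \<and> f \<in> \<Omega>[at_top](\<lambda>x. x powr (c + \<delta> x))"
proof -
  \<comment> \<open>The hypothesis bounds the true exponent of \<open>f\<close> only from below; the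
    cap at 0 supplies the other half of the convergence.\<close>
  define \<delta> where "\<delta> = (\<lambda>x. min 0 (ln (f x) / ln x - c))"
  have "(\<delta> \<longlongrightarrow> 0) at_top"
  proof (rule tendstoI)
    fix e :: real assume "e > 0"
    then have "\<forall>\<^sub>F x in at_top. f x \<ge> x powr (c - e / 2)"
      by (intro assms) auto
    then show "\<forall>\<^sub>F x in at_top. dist (\<delta> x) 0 < e"
      using eventually_gt_at_top[of 1]
    proof eventually_elim
      case (elim x)
      have "(c - e / 2) * ln x = ln (x powr (c - e / 2))"
        using elim by (simp add: ln_powr)
      also have "\<dots> \<le> ln (f x)"
        using elim by (intro ln_mono) auto
      finally have "c - e / 2 \<le> ln (f x) / ln x"
        using elim by (simp add: field_simps)
      then show ?case
        using \<open>e > 0\<close> by (auto simp: \<delta>_def dist_real_def)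
    qed
  qed
  then have "\<delta> \<in> o[at_top](\<lambda>_. 1)"
    by (intro smalloI_tendsto) auto
  moreover have "\<forall>\<^sub>F x in at_top. norm (f x) \<ge> 1 * norm (x powr (c + \<delta> x))"
    \<comment> \<open>The instance \<open>e = 1\<close> serves only to make \<open>f x\<close>
      positive.\<close>
    using assms[OF zero_less_one] eventually_gt_at_top[of 1]
  proof eventually_elim
    case (elim x)
    have "x powr (c - 1) > 0"
      using elim by simp
    then have "f x > 0"
      using elim by linarith
    have "x powr (c + \<delta> x) \<le> x powr (ln (f x) / ln x)"
      using elim by (intro powr_mono) (auto simp: \<delta>_def)
    also have "\<dots> = f x"
      using elim \<open>f x > 0\<close> by (simp add: powr_def)
    finally show ?case
      using \<open>f x > 0\<close> by simp
  qed
  then have "f \<in> \<Omega>[at_top](\<lambda>x. x powr (c + \<delta> x))"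
    by (intro landau_omega.bigI[of 1]) auto
  ultimately show ?thesis
    by blast
qed

theorem theorem1:
  fixes u :: real
  assumes "0 < u" and "u < 1"
    and "\<exists>\<epsilon>::real \<Rightarrow> real. \<epsilon> \<in> o[at_top](\<lambda>_. 1) \<and>
           (\<forall>\<^sub>F z in at_top.
              real (smooth_shifted_prime_count z (z powr u)) = z powr (1 + \<epsilon> z))"
  shows "\<exists>\<delta>::real \<Rightarrow> real. \<delta> \<in> o[at_top](\<lambda>_. 1) \<and>
           (\<lambda>x. real (novak_carmichael_count x)) \<in> \<Omega>[at_top](\<lambda>x. x powr (1 - u + \<delta> x))"
proof (rule exists_little_o_exponent)
  fix e :: real assume "e > 0"
  \<comment> \<open>\<open>e / 3\<close> absorbs the loss \<open>3 * d\<close>;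
    \<open>(1 - u) / 4\<close> keeps \<open>u + 2 * d \<le> (1 + u) / 2 < 1\<close>.\<close>
  define d where "d = min (e / 3) ((1 - u) / 4)"
  define v where "v = u + d"
  have d: "d > 0" "3 * d \<le> e" "u + 2 * d < 1"
    using \<open>e > 0\<close> \<open>u < 1\<close> by (auto simp: d_def min_def field_simps)
  have v: "u < v" "v > 0"
    using d \<open>0 < u\<close> by (auto simp: v_def)
  obtain \<epsilon> :: "real \<Rightarrow> real" where "\<epsilon> \<in> o[at_top](\<lambda>_. 1)"
    and \<epsilon>: "\<forall>\<^sub>F z in at_top. real (smooth_shifted_prime_count z (z powr u)) = z powr (1 + \<epsilon> z)"
    using assms(3) by blast
  then have "\<forall>\<^sub>F z in at_top. norm (\<epsilon> z) \<le> d * norm (1::real)"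
    using d(1) landau_o.smallD by blast
  moreover have "\<forall>\<^sub>F z in at_top. (z powr u + 1) * ln z \<le> d * z powr v"
    using \<open>0 < u\<close> v d(1) by real_asymp
  ultimately have "\<forall>\<^sub>F z in at_top.
      real (novak_carmichael_count (exp (z powr v))) \<ge> exp (z powr v) powr (1 - u - 3 * d)"
    using \<epsilon> eventually_ge_at_top[of "exp 1"]
  proof eventually_elim
    case (elim z)
    have "z > 1"
      using elim exp_gt_one[of "1::real"] by linarith
    then have "z powr (1 - d) \<le> z powr (1 + \<epsilon> z)"
      using elim by (intro powr_mono) auto
    then show ?case
      using elim \<open>0 < u\<close> d unfolding v_def by (intro novak_carmichael_count_ge) auto
  qed
  \<comment> \<open>Inverts \<open>x = exp (z powr v)\<close>, so the bound along \<open>z\<close>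
    covers all large real \<open>x\<close>.\<close>
  moreover have "filterlim (\<lambda>x::real. ln x powr (1 / v)) at_top at_top"
    using v(2) by real_asymp
  ultimately have "\<forall>\<^sub>F x in at_top.
      real (novak_carmichael_count (exp ((ln x powr (1 / v)) powr v)))
        \<ge> exp ((ln x powr (1 / v)) powr v) powr (1 - u - 3 * d)"
    by (rule eventually_compose_filterlim)
  then show "\<forall>\<^sub>F x in at_top. real (novak_carmichael_count x) \<ge> x powr (1 - u - e)"
    using eventually_gt_at_top[of 1]
  proof eventually_elim
    case (elim x)
    then have "exp ((ln x powr (1 / v)) powr v) = x"
      using v(2) by (simp add: powr_powr)
    then have "x powr (1 - u - 3 * d) \<le> real (novak_carmichael_count x)"
      using elim by simp
    moreover have "x powr (1 - u - e) \<le> x powr (1 - u - 3 * d)"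
      using elim d by (intro powr_mono) auto
    ultimately show ?case
      by linarith
  qed
qed

end
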